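(* There exist integers $k\ge1$, $n>k$ and type distributions $\mathbf G$ for $n$ agents such that both $$\mathrm{innerLP}^{\mathsf{ST}/\mathsf{Proph}}_{k,n}(\mathbf G)>\sup_{J,\rho}\mathrm{innerLP}^{\mathsf{OST}(J,\rho)/\mathsf{Proph}}_{k,n}(\mathbf G)$$ and $$\mathrm{innerLP}^{\mathsf{ST}/\mathsf{ExAnte}}_{k,n}(\mathbf G)>\sup_{J,\rho}\mathrm{innerLP}^{\mathsf{OST}(J,\rho)/\mathsf{ExAnte}}_{k,n}(\mathbf G),$$ where the suprema are over $J\in[m]$ ($m$ being the number of types of $\mathbf G$) and $\rho\in(0,1]$.
   Context: $[n]=\{1,\dots,n\}$. $\mathrm{Ber}(p)$ denotes a Bernoulli random variable with mean $p$; all Bernoulli variables in a sum are independent. Type distributions $\mathbf G$ (for $n$ agents): a positive integer $m$ and numbers $G_{ij}$, $i\in[n]$, $j\in\{0,1,\dots,m\}$, with $0=G_{i0}\le G_{i1}\le\cdots\le G_{im}=1$ for every $i$. $\mathcal P^k_n$ is the set of pairs $(\mathbf x,\mathbf y)$ of real arrays $\mathbf x=(x^l_i)_{i\in[n],l\in[k]}$, $\mathbf y=(y^l_i)_{i\in[n],l\in[k]}$ such that $0\le y^l_i\le x^l_i$ for all $i,l$; $x^k_1=1$; $x^l_1=0$ for $l<k$; and $x^l_i=x^l_{i-1}-y^l_{i-1}+y^{l+1}_{i-1}$ for all $i>1$, $l\in[k]$, with the convention $y^{k+1}_{i}=0$. Put $Q_j=\mathbb E[\min\{\sum_{i=1}^n\mathrm{Ber}(G_{ij}),k\}]$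 in the problems with superscript "$/\mathsf{Proph}$" and $Q_j=\min\{\sum_{i=1}^nG_{ij},k\}$ in those with superscript "$/\mathsf{ExAnte}$". For $J\in[m]$, $\rho\in(0,1]$, $\mathrm{innerLP}^{\mathsf{OST}(J,\rho)/\cdot}_{k,n}(\mathbf G)$ is the optimal value of: maximize $\theta$ over real $\theta$ and $(\mathbf x,\mathbf y)\in\mathcal P^k_n$ subject to $$\theta\cdot Q_j\le\sum_{i=1}^n\sum_{l=1}^k\min\{y^l_i,G_{ij}x^l_i\}\quad\forall j\in[m],\qquad y^l_i=((1-\rho)G_{i,J-1}+\rho G_{iJ})x^l_i\quad\forall i\in[n],l\in[k].$$ For each $(J,\rho)$ let $(\mathbf x(J,\rho),\mathbf y(J,\rho))$ be the unique element of $\mathcal P^k_n$ with $y^l_i(J,\rho)=((1-\rho)G_{i,J-1}+\rho G_{iJ})x^l_i(J,\rho)$ for all $i,l$. Then $\mathrm{innerLP}^{\mathsf{ST}/\cdot}_{k,n}(\mathbf G)$ is the optimal value (supremum) of $\theta$ over real $\theta$ and probability measures $\mu$ on $[m]\times(0,1]$ subject to $$\theta\cdot Q_j\le\int\Big(\sum_{i=1}^n\sum_{l=1}^k\min\{y^l_i(J,\rho),G_{ij}x^l_i(J,\rho)\}\Big)\,d\mu(J,\rho)\quad\forall j\in[m].$$ *)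

theory Defs
  imports "HOL-Probability.Probability"
begin

definition type_distributions :: "nat \<Rightarrow> nat \<Rightarrow> (nat \<Rightarrow> nat \<Rightarrow> real) \<Rightarrow> bool" where
  "type_distributions n m G \<longleftrightarrow>
     m \<ge> 1 \<and>
     (\<forall>i\<in>{1..n}. G i 0 = 0 \<and> G i m = 1 \<and> (\<forall>j\<in>{1..m}. G i (j - 1) \<le> G i j))"

text \<open>
  An array $(x^l_i)_{i \in [n], l \in [k]}$ is a function applied as \<open>x i l\<close> (agent first)
  that vanishes outside \<open>{1..n} \<times> {1..k}\<close>. Functions of this kind correspond one-to-one to
  arrays, and \<open>y i (k + 1) = 0\<close> then holds as the convention $y^{k+1}_i = 0$ requires.
\<close>

definition arrays :: "nat \<Rightarrow> nat \<Rightarrow> (nat \<Rightarrow> nat \<Rightarrow> real) set" where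
  "arrays k n = {x. \<forall>i l. \<not> (i \<in> {1..n} \<and> l \<in> {1..k}) \<longrightarrow> x i l = 0}"

definition P_set :: "nat \<Rightarrow> nat \<Rightarrow> ((nat \<Rightarrow> nat \<Rightarrow> real) \<times> (nat \<Rightarrow> nat \<Rightarrow> real)) set" where
  "P_set k n = {(x, y). x \<in> arrays k n \<and> y \<in> arrays k n \<and>
     (\<forall>i\<in>{1..n}. \<forall>l\<in>{1..k}. 0 \<le> y i l \<and> y i l \<le> x i l) \<and>
     x 1 k = 1 \<and> (\<forall>l\<in>{1..<k}. x 1 l = 0) \<and>
     (\<forall>i\<in>{2..n}. \<forall>l\<in>{1..k}. x i l = x (i - 1) l - y (i - 1) l + y (i - 1) (l + 1))}"

definition Q_Proph :: "nat \<Rightarrow> nat \<Rightarrow> (nat \<Rightarrow> nat \<Rightarrow> real) \<Rightarrow> nat \<Rightarrow> real" where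
  "Q_Proph k n G j =
     measure_pmf.expectation (Pi_pmf {1..n} False (\<lambda>i. bernoulli_pmf (G i j)))
       (\<lambda>b. min (\<Sum>i=1..n. of_bool (b i)) (real k))"

definition Q_ExAnte :: "nat \<Rightarrow> nat \<Rightarrow> (nat \<Rightarrow> nat \<Rightarrow> real) \<Rightarrow> nat \<Rightarrow> real" where
  "Q_ExAnte k n G j = min (\<Sum>i=1..n. G i j) (real k)"

definition accept_prob :: "(nat \<Rightarrow> nat \<Rightarrow> real) \<Rightarrow> nat \<Rightarrow> real \<Rightarrow> nat \<Rightarrow> real" where
  "accept_prob G J \<rho> i = (1 - \<rho>) * G i (J - 1) + \<rho> * G i J"

definition threshold_policy ::
  "nat \<Rightarrow> nat \<Rightarrow> (nat \<Rightarrow> nat \<Rightarrow> real) \<Rightarrow> nat \<Rightarrow> real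
     \<Rightarrow> (nat \<Rightarrow> nat \<Rightarrow> real) \<times> (nat \<Rightarrow> nat \<Rightarrow> real) \<Rightarrow> bool" where
  "threshold_policy k n G J \<rho> = (\<lambda>(x, y).
     \<forall>i\<in>{1..n}. \<forall>l\<in>{1..k}. y i l = accept_prob G J \<rho> i * x i l)"

definition type_value ::
  "nat \<Rightarrow> nat \<Rightarrow> (nat \<Rightarrow> nat \<Rightarrow> real) \<Rightarrow> nat
     \<Rightarrow> (nat \<Rightarrow> nat \<Rightarrow> real) \<times> (nat \<Rightarrow> nat \<Rightarrow> real) \<Rightarrow> real" where
  "type_value k n G j = (\<lambda>(x, y).
     \<Sum>i=1..n. \<Sum>l=1..k. min (y i l) (G i j * x i l))"

text \<open>
  In both problems \<open>Q\<close> is \<open>Q_Proph k n G\<close> or \<open>Q_ExAnte k n G\<close>, and the optimal value is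
  taken in the extended reals, where every set of objective values has a supremum.
\<close>

definition innerLP_OST ::
  "(nat \<Rightarrow> real) \<Rightarrow> nat \<Rightarrow> nat \<Rightarrow> nat \<Rightarrow> (nat \<Rightarrow> nat \<Rightarrow> real) \<Rightarrow> nat \<Rightarrow> real \<Rightarrow> ereal" where
  "innerLP_OST Q k n m G J \<rho> =
     Sup {ereal \<theta> | \<theta> x y. (x, y) \<in> P_set k n \<and>
       (\<forall>j\<in>{1..m}. \<theta> * Q j \<le> type_value k n G j (x, y)) \<and>
       threshold_policy k n G J \<rho> (x, y)}"

definition threshold_xy ::
  "nat \<Rightarrow> nat \<Rightarrow> (nat \<Rightarrow> nat \<Rightarrow> real) \<Rightarrow> nat \<Rightarrow> real
     \<Rightarrow> (nat \<Rightarrow> nat \<Rightarrow> real) \<times> (nat \<Rightarrow> nat \<Rightarrow> real)" where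
  "threshold_xy k n G J \<rho> = (THE xy. xy \<in> P_set k n \<and> threshold_policy k n G J \<rho> xy)"

definition threshold_space :: "nat \<Rightarrow> (nat \<times> real) measure" where
  "threshold_space m = count_space {1..m} \<Otimes>\<^sub>M restrict_space borel {0<..1}"

definition innerLP_ST ::
  "(nat \<Rightarrow> real) \<Rightarrow> nat \<Rightarrow> nat \<Rightarrow> nat \<Rightarrow> (nat \<Rightarrow> nat \<Rightarrow> real) \<Rightarrow> ereal" where
  "innerLP_ST Q k n m G =
     Sup {ereal \<theta> | \<theta> \<mu>. prob_space \<mu> \<and> sets \<mu> = sets (threshold_space m) \<and>
       (\<forall>j\<in>{1..m}. \<theta> * Q j \<le> (\<integral>(J, \<rho>). type_value k n G j (threshold_xy k n G J \<rho>) \<partial>\<mu>))}"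

end

(* One unit and two agents suffice. In the acceptance probabilities (a1, a2) the thresholds trace
   the path (0,0) - (0,1/2) - (1/3,1/2) - (1/3,1) - (1,1). The value at the last type, with
   benchmark 1, is a1 + (1 - a1) a2; the value at the first type, with benchmark 1/2, is at most
   (1 - a1)/2. Up to the vertex (1/3,1/2) the former is at most 2/3; from there on the latter is at
   most 1/3. So a single threshold never guarantees more than 2/3. The chord from (0,1/2) to
   (1/3,1) avoids this vertex, where the curve formed by the two values has a non-concave kink: an
   equal mixture of these two thresholds guarantees 7/10. Of the benchmarks only
   G 2 j <= Q j <= min {G 1 j + G 2 j, 1} matters, which is true of Proph and ExAnte alike. *)

theory Submission
  imports Defs
begin

text \<open>This is Jensen's inequality for the concave map min(., k). The expectation is bounded
  once by that of the untruncated sum, whose summands have the marginals Ber(G i j), and once by the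
  constant k.\<close>

lemma Q_Proph_le_Q_ExAnte:
  assumes "\<And>i. i \<in> {1..n} \<Longrightarrow> G i j \<in> {0..1}"
  shows "Q_Proph k n G j \<le> Q_ExAnte k n G j"
proof -
  let ?p = "Pi_pmf {1..n} False (\<lambda>i. bernoulli_pmf (G i j))"
  let ?f = "\<lambda>b. min (\<Sum>i=1..n. of_bool (b i)) (real k) :: real"
  have coord: "measure_pmf.expectation ?p (\<lambda>b. of_bool (b i)) = G i j" if "i \<in> {1..n}" for i
  proof -
    have "measure_pmf.expectation ?p (\<lambda>b. of_bool (b i) :: real) =
        measure_pmf.expectation (map_pmf (\<lambda>b. b i) ?p) of_bool"
      by simp
    then show ?thesis
      using that assms[OF that] by (simp add: Pi_pmf_component)
  qed
  have int: "integrable (measure_pmf ?p) (\<lambda>b. of_bool (b i) :: real)" for i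
    by (rule measure_pmf.integrable_const_bound[where B = 1]) auto
  have intf: "integrable (measure_pmf ?p) ?f"
    by (rule measure_pmf.integrable_const_bound[where B = k]) (auto simp: sum_nonneg)
  have "measure_pmf.expectation ?p ?f \<le> measure_pmf.expectation ?p (\<lambda>b. \<Sum>i=1..n. of_bool (b i))"
    by (rule integral_mono[OF intf Bochner_Integration.integrable_sum[OF int]]) simp
  also have "\<dots> = (\<Sum>i=1..n. G i j)"
    by (subst Bochner_Integration.integral_sum[OF int]) (rule sum.cong[OF refl coord])
  finally have "Q_Proph k n G j \<le> (\<Sum>i=1..n. G i j)"
    by (simp add: Q_Proph_def)
  moreover have "measure_pmf.expectation ?p ?f \<le> measure_pmf.expectation ?p (\<lambda>b. real k)"
    using intf by (intro integral_mono) auto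
  ultimately show ?thesis
    by (simp add: Q_Proph_def Q_ExAnte_def)
qed

text \<open>Since k >= 1, the truncated count dominates the indicator of agent i alone pointwise,
  and that indicator has mean \<open>G i j\<close>.\<close>

lemma le_Q_Proph:
  assumes "G i j \<in> {0..1}" "i \<in> {1..n}" "k \<ge> 1"
  shows "G i j \<le> Q_Proph k n G j"
proof -
  let ?p = "Pi_pmf {1..n} False (\<lambda>i. bernoulli_pmf (G i j))"
  let ?f = "\<lambda>b. min (\<Sum>i=1..n. of_bool (b i)) (real k) :: real"
  have "G i j = measure_pmf.expectation (map_pmf (\<lambda>b. b i) ?p) of_bool"
    using assms by (simp add: Pi_pmf_component)
  also have "\<dots> = measure_pmf.expectation ?p (\<lambda>b. of_bool (b i))"
    by simp
  also have "\<dots> \<le> measure_pmf.expectation ?p ?f"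
  proof (rule integral_mono)
    show "integrable (measure_pmf ?p) (\<lambda>b. of_bool (b i) :: real)"
      by (rule measure_pmf.integrable_const_bound[where B = 1]) auto
    show "integrable (measure_pmf ?p) ?f"
      by (rule measure_pmf.integrable_const_bound[where B = k]) (auto simp: sum_nonneg)
    fix b :: "nat \<Rightarrow> bool"
    have "of_bool (b i) \<le> (\<Sum>i=1..n. of_bool (b i) :: real)"
      using assms(2) by (intro member_le_sum) auto
    then show "of_bool (b i) \<le> ?f b"
      using assms(3) by (cases "b i") (auto simp: sum_nonneg)
  qed
  finally show ?thesis
    by (simp add: Q_Proph_def)
qed

text \<open>The unit reaches agent 2 exactly when agent 1 was turned down, hence the factor 1 - a.
  The zeros elsewhere are those demanded by \<open>arrays\<close>, so that uniqueness can be an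
  equality of functions.\<close>

definition single_unit_policy ::
  "real \<Rightarrow> real \<Rightarrow> (nat \<Rightarrow> nat \<Rightarrow> real) \<times> (nat \<Rightarrow> nat \<Rightarrow> real)" where
  "single_unit_policy a b =
     ((\<lambda>i l. if l = 1 then if i = 1 then 1 else if i = 2 then 1 - a else 0 else 0),
      (\<lambda>i l. if l = 1 then if i = 1 then a else if i = 2 then b * (1 - a) else 0 else 0))"

lemma atLeastAtMost_1_2: "{Suc 0..2} = {Suc 0, 2}"
  by auto

text \<open>Serves two purposes: it evaluates the \<open>THE\<close> in \<open>threshold_xy\<close>,
  and it shows that a fixed threshold leaves only \<theta> free in
  \<open>innerLP_OST\<close>.\<close>

lemma single_unit_policy_unique:
  assumes "accept_prob G J \<rho> 1 \<in> {0..1}" "accept_prob G J \<rho> 2 \<in> {0..1}"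
  shows "xy \<in> P_set 1 2 \<and> threshold_policy 1 2 G J \<rho> xy \<longleftrightarrow>
    xy = single_unit_policy (accept_prob G J \<rho> 1) (accept_prob G J \<rho> 2)"
proof
  assume "xy = single_unit_policy (accept_prob G J \<rho> 1) (accept_prob G J \<rho> 2)"
  then show "xy \<in> P_set 1 2 \<and> threshold_policy 1 2 G J \<rho> xy"
    using assms
    by (auto simp: P_set_def arrays_def threshold_policy_def single_unit_policy_def
        atLeastAtMost_1_2 mult_left_le_one_le)
next
  assume *: "xy \<in> P_set 1 2 \<and> threshold_policy 1 2 G J \<rho> xy"
  obtain x y where xy: "xy = (x, y)" by fastforce
  have zero: "x i l = 0" "y i l = 0" if "\<not> (i \<in> {1..2} \<and> l \<in> {1..1})" for i l
    using * that unfolding xy P_set_def arrays_def by blast+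
  \<comment> \<open>The instance of \<open>zero(2)\<close> is the convention that y vanishes at
    level k + 1 = 2, which removes the last term of the recursion for \<open>x 2 1\<close>.\<close>
  have vals: "x 1 1 = 1" "y 1 1 = accept_prob G J \<rho> 1" "x 2 1 = 1 - accept_prob G J \<rho> 1"
      "y 2 1 = accept_prob G J \<rho> 2 * (1 - accept_prob G J \<rho> 1)"
    using * zero(2)[of 1 2] unfolding xy P_set_def threshold_policy_def
    by (auto simp: atLeastAtMost_1_2 numeral_2_eq_2)
  have "x i l = fst (single_unit_policy (accept_prob G J \<rho> 1) (accept_prob G J \<rho> 2)) i l"
       "y i l = snd (single_unit_policy (accept_prob G J \<rho> 1) (accept_prob G J \<rho> 2)) i l" for i l
    using vals zero[of i l] by (auto simp: single_unit_policy_def)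
  then show "xy = single_unit_policy (accept_prob G J \<rho> 1) (accept_prob G J \<rho> 2)"
    unfolding xy prod_eq_iff fst_conv snd_conv by (intro conjI ext)
qed

lemma threshold_xy_single_unit:
  assumes "accept_prob G J \<rho> 1 \<in> {0..1}" "accept_prob G J \<rho> 2 \<in> {0..1}"
  shows "threshold_xy 1 2 G J \<rho> = single_unit_policy (accept_prob G J \<rho> 1) (accept_prob G J \<rho> 2)"
  unfolding threshold_xy_def single_unit_policy_unique[OF assms] by simp

lemma type_value_single_unit_policy:
  "type_value 1 2 G j (single_unit_policy a b) = min a (G 1 j) + min (b * (1 - a)) (G 2 j * (1 - a))"
  unfolding type_value_def single_unit_policy_def by (simp add: atLeastAtMost_1_2)

lemma accept_prob_bounds:
  assumes "G i (J - 1) \<in> {0..1}" "G i J \<in> {0..1}" "\<rho> \<in> {0<..1}"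
  shows "accept_prob G J \<rho> i \<in> {0..1}"
proof -
  have "accept_prob G J \<rho> i \<le> (1 - \<rho>) * 1 + \<rho> * 1"
    unfolding accept_prob_def using assms by (intro add_mono mult_left_mono) auto
  then show ?thesis
    using assms by (auto simp: accept_prob_def)
qed

text \<open>Agent 1 has type 2 with probability 1/3 and type 4 otherwise; agent 2 has type 1 or 3
  with probability 1/2 each. The supports are disjoint, so each J moves only one acceptance
  probability.\<close>

definition gap_instance :: "nat \<Rightarrow> nat \<Rightarrow> real" where
  "gap_instance i j =
     (if i = 1 then if j \<le> 1 then 0 else if j \<le> 3 then 1/3 else 1
      else if j = 0 then 0 else if j \<le> 2 then 1/2 else 1)"

lemma gap_instance_bounds: "gap_instance i j \<in> {0..1}"
  by (simp add: gap_instance_def)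

lemma gap_accept_prob_bounds: "\<rho> \<in> {0<..1} \<Longrightarrow> accept_prob gap_instance J \<rho> i \<in> {0..1}"
  by (intro accept_prob_bounds gap_instance_bounds)

lemma type_value_threshold_gap:
  assumes "\<rho> \<in> {0<..1}"
  shows "type_value 1 2 gap_instance j (threshold_xy 1 2 gap_instance J \<rho>) =
    min (accept_prob gap_instance J \<rho> 1) (gap_instance 1 j) +
    min (accept_prob gap_instance J \<rho> 2 * (1 - accept_prob gap_instance J \<rho> 1))
      (gap_instance 2 j * (1 - accept_prob gap_instance J \<rho> 1))"
  using gap_accept_prob_bounds[OF assms]
  by (simp only: threshold_xy_single_unit type_value_single_unit_policy)

lemma innerLP_OST_gap_le:
  assumes "Q 1 \<ge> 1/2" "Q 4 \<ge> 1" "J \<in> {1..4}" "\<rho> \<in> {0<..1}"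
  shows "innerLP_OST Q 1 2 4 gap_instance J \<rho> \<le> ereal (2/3)"
proof -
  have "\<theta> \<le> 2/3"
    if P: "(x, y) \<in> P_set 1 2" "threshold_policy 1 2 gap_instance J \<rho> (x, y)"
      and \<theta>: "\<forall>j\<in>{1..4}. \<theta> * Q j \<le> type_value 1 2 gap_instance j (x, y)" for \<theta> x y
  proof (rule ccontr)
    assume "\<not> \<theta> \<le> 2/3"
    then have "\<theta> > 2/3" by simp
    \<comment> \<open>The contradiction hypothesis also makes \<theta> positive, so the lower bounds
      on the benchmarks can be scaled by it.\<close>
    then have "\<theta> * (1/2) \<le> \<theta> * Q 1" "\<theta> * 1 \<le> \<theta> * Q 4"
      using assms by (intro mult_left_mono; simp)+
    moreover have "\<theta> * Q 1 \<le> type_value 1 2 gap_instance 1 (x, y)"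
        "\<theta> * Q 4 \<le> type_value 1 2 gap_instance 4 (x, y)"
      using \<theta> by auto
    moreover have "(x, y) =
        single_unit_policy (accept_prob gap_instance J \<rho> 1) (accept_prob gap_instance J \<rho> 2)"
      using P single_unit_policy_unique[OF gap_accept_prob_bounds gap_accept_prob_bounds] assms(4)
      by blast
    ultimately have V: "1/3 < type_value 1 2 gap_instance 1
          (single_unit_policy (accept_prob gap_instance J \<rho> 1) (accept_prob gap_instance J \<rho> 2))"
        "2/3 < type_value 1 2 gap_instance 4
          (single_unit_policy (accept_prob gap_instance J \<rho> 1) (accept_prob gap_instance J \<rho> 2))"
      using \<open>\<theta> > 2/3\<close> by (simp_all only:)
    have "J = 1 \<or> J = 2 \<or> J = 3 \<or> J = 4"
      using assms(3) by auto
    \<comment> \<open>For J = 1, 2 the value at type 4 is at most 2/3, with equality at J = 2,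
      \<rho> = 1. For J = 3, 4 the value at type 1 is (1 - a1)/2 with a1 >= 1/3, hence at most
      1/3.\<close>
    then show False
      using V assms(4) unfolding type_value_single_unit_policy
      by (elim disjE)
        (auto simp: accept_prob_def gap_instance_def min_def field_simps split: if_splits)
  qed
  then show ?thesis
    unfolding innerLP_OST_def by (intro Sup_least) auto
qed

text \<open>The closed form replaces the \<open>THE\<close> only for \<rho> in (0,1], so the
  congruence is taken on the restricted space. The coordinate J is countable and can be fixed
  first.\<close>

lemma type_value_gap_measurable:
  "(\<lambda>(J, \<rho>). type_value 1 2 gap_instance j (threshold_xy 1 2 gap_instance J \<rho>))
     \<in> borel_measurable (threshold_space m)"
proof -
  let ?M = "restrict_space borel {0<..1::real}"
  have "(\<lambda>\<rho>. type_value 1 2 gap_instance j (threshold_xy 1 2 gap_instance J \<rho>))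
      \<in> borel_measurable ?M" for J
  proof (subst measurable_cong)
    show "type_value 1 2 gap_instance j (threshold_xy 1 2 gap_instance J \<rho>) =
        min (accept_prob gap_instance J \<rho> 1) (gap_instance 1 j) +
        min (accept_prob gap_instance J \<rho> 2 * (1 - accept_prob gap_instance J \<rho> 1))
          (gap_instance 2 j * (1 - accept_prob gap_instance J \<rho> 1))"
      if "\<rho> \<in> space ?M" for \<rho>
      using that by (intro type_value_threshold_gap) (simp add: space_restrict_space)
  next
    show "(\<lambda>\<rho>. min (accept_prob gap_instance J \<rho> 1) (gap_instance 1 j) +
        min (accept_prob gap_instance J \<rho> 2 * (1 - accept_prob gap_instance J \<rho> 1))
          (gap_instance 2 j * (1 - accept_prob gap_instance J \<rho> 1))) \<in> borel_measurable ?M"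
      unfolding accept_prob_def by (intro measurable_restrict_space1) measurable
  qed
  then show ?thesis
    unfolding threshold_space_def by (intro measurable_pair_measure_countable1) auto
qed

lemma innerLP_ST_gap_ge:
  assumes "\<And>j. j \<in> {1..4} \<Longrightarrow> Q j \<le> Q_ExAnte 1 2 gap_instance j"
  shows "innerLP_ST Q 1 2 4 gap_instance \<ge> ereal (7/10)"
proof -
  let ?T = "threshold_space 4"
  \<comment> \<open>The two outcomes of a fair coin select the acceptance probabilities (0, 1/2) and
    (1/3, 1).\<close>
  let ?f = "\<lambda>c. if c then (1, 1) else (3, 1) :: nat \<times> real"
  let ?B = "measure_pmf (bernoulli_pmf (1/2))"
  define \<mu> where "\<mu> = distr ?B ?T ?f"
  have f: "?f \<in> measurable ?B ?T"
    by (auto simp: threshold_space_def space_pair_measure space_restrict_space)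
  have "prob_space \<mu>"
    unfolding \<mu>_def using f by (rule measure_pmf.prob_space_distr)
  moreover have "sets \<mu> = sets ?T"
    by (simp add: \<mu>_def)
  moreover have "7/10 * Q j \<le>
      (\<integral>(J, \<rho>). type_value 1 2 gap_instance j (threshold_xy 1 2 gap_instance J \<rho>) \<partial>\<mu>)"
    if j: "j \<in> {1..4}" for j
  proof -
    have "(\<integral>(J, \<rho>). type_value 1 2 gap_instance j (threshold_xy 1 2 gap_instance J \<rho>) \<partial>\<mu>) =
        type_value 1 2 gap_instance j (threshold_xy 1 2 gap_instance 1 1) / 2 +
        type_value 1 2 gap_instance j (threshold_xy 1 2 gap_instance 3 1) / 2"
      unfolding \<mu>_def by (subst integral_distr[OF f type_value_gap_measurable]) simp
    moreover have "j = 1 \<or> j = 2 \<or> j = 3 \<or> j = 4"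
      using j by auto
    \<comment> \<open>For j = 1, 2, 3, 4 the mixture earns 5/12, 7/12, 3/4, 3/4 against the
      benchmarks 1/2, 5/6, 1, 1. The smallest ratio is 7/10, at j = 2.\<close>
    then have "7/10 * Q_ExAnte 1 2 gap_instance j \<le>
        type_value 1 2 gap_instance j (threshold_xy 1 2 gap_instance 1 1) / 2 +
        type_value 1 2 gap_instance j (threshold_xy 1 2 gap_instance 3 1) / 2"
      by (subst (1 2) type_value_threshold_gap)
        (auto simp: accept_prob_def gap_instance_def Q_ExAnte_def atLeastAtMost_1_2)
    ultimately show ?thesis
      using assms[OF j] by linarith
  qed
  ultimately show ?thesis
    unfolding innerLP_ST_def by (intro Sup_upper) blast
qed

text \<open>The lower bound on Q caps the single thresholds, and the upper bound supports the
  mixture; keeping Q abstract covers both benchmarks.\<close>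

lemma gap_instance_separates:
  assumes "\<And>j. j \<in> {1..4} \<Longrightarrow> gap_instance 2 j \<le> Q j"
    and "\<And>j. j \<in> {1..4} \<Longrightarrow> Q j \<le> Q_ExAnte 1 2 gap_instance j"
  shows "innerLP_ST Q 1 2 4 gap_instance >
    (SUP (J, \<rho>)\<in>{1..4} \<times> {0<..1}. innerLP_OST Q 1 2 4 gap_instance J \<rho>)"
proof -
  have "Q 1 \<ge> 1/2" "Q 4 \<ge> 1"
    using assms(1)[of 1] assms(1)[of 4] by (simp_all add: gap_instance_def)
  then have "(SUP (J, \<rho>)\<in>{1..4} \<times> {0<..1}. innerLP_OST Q 1 2 4 gap_instance J \<rho>) \<le> ereal (2/3)"
    by (intro SUP_least) (use innerLP_OST_gap_le in auto)
  also have "\<dots> < ereal (7/10)"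
    by simp
  also have "\<dots> \<le> innerLP_ST Q 1 2 4 gap_instance"
    using assms(2) by (intro innerLP_ST_gap_ge)
  finally show ?thesis .
qed

theorem proposition4:
  "\<exists>(k::nat) (n::nat) (m::nat) (G :: nat \<Rightarrow> nat \<Rightarrow> real).
     k \<ge> 1 \<and> n > k \<and> type_distributions n m G \<and>
     innerLP_ST (Q_Proph k n G) k n m G
       > (SUP (J, \<rho>)\<in>{1..m} \<times> {0<..1}. innerLP_OST (Q_Proph k n G) k n m G J \<rho>) \<and>
     innerLP_ST (Q_ExAnte k n G) k n m G
       > (SUP (J, \<rho>)\<in>{1..m} \<times> {0<..1}. innerLP_OST (Q_ExAnte k n G) k n m G J \<rho>)"
proof (intro exI conjI)
  show "(1::nat) \<ge> 1" "(2::nat) > 1"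
    by simp_all
  show "type_distributions 2 4 gap_instance"
    by (auto simp: type_distributions_def gap_instance_def)
  have le_Proph: "gap_instance 2 j \<le> Q_Proph 1 2 gap_instance j" for j
    by (intro le_Q_Proph gap_instance_bounds) auto
  have Proph_le: "Q_Proph 1 2 gap_instance j \<le> Q_ExAnte 1 2 gap_instance j" for j
    by (intro Q_Proph_le_Q_ExAnte gap_instance_bounds)
  show "innerLP_ST (Q_Proph 1 2 gap_instance) 1 2 4 gap_instance >
      (SUP (J, \<rho>)\<in>{1..4} \<times> {0<..1}.
        innerLP_OST (Q_Proph 1 2 gap_instance) 1 2 4 gap_instance J \<rho>)"
    by (intro gap_instance_separates le_Proph Proph_le)
  show "innerLP_ST (Q_ExAnte 1 2 gap_instance) 1 2 4 gap_instance >
      (SUP (J, \<rho>)\<in>{1..4} \<times> {0<..1}.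
        innerLP_OST (Q_ExAnte 1 2 gap_instance) 1 2 4 gap_instance J \<rho>)"
    \<comment> \<open>The lower bound for \<open>Q_ExAnte\<close> is obtained by passing through
      \<open>Q_Proph\<close>.\<close>
    by (intro gap_instance_separates order.trans[OF le_Proph Proph_le] order.refl)
qed

end
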